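(* Let $(T_i,X_i,Y_i)$, $i=1,2,\ldots$, be i.i.d. copies of $(T,X,Y)$ with $Y=TY(1)+(1-T)Y(0)$. Assume: (i) $Y(t)$ is conditionally independent of $T$ given $X$, for $t=0,1$; (ii) there is $\eta>0$ with $\eta<e(X)<1-\eta$ almost surely, where $e(X)=P(T=1\mid X)$; (iii) $\hat\beta^*\stackrel{p}{\longrightarrow}\beta^*$ as $n\to\infty$; (iv) there is $\nu>0$ with $\nu<e^*(X)<1-\nu$ almost surely, where $e^*(X)=e^{\mathrm{mis}}(X,\beta^* )$; (v) the weak law of large numbers with estimated parameter holds for the summands of the estimator, in the sense specified in the context. Let $$\hat\Delta^*_{\mathrm{IPW}_1}=\frac1n\sum_{i=1}^n\frac{T_iY_i}{\hat e^*(X_i)}-\frac1n\sum_{i=1}^n\frac{(1-T_i)Y_i}{1-\hat e^*(X_i)},\qquad \hat e^*(X_i)=e^{\mathrm{mis}}(X_i,\hat\beta^* ).$$ Then, as $n\to\infty$, $$\hat\Delta^*_{\mathrm{IPW}_1}-\Delta\stackrel{p}{\longrightarrow}E\left[\frac{e(X)}{e^*(X)}\mu_1(X)\right]-E\left[\frac{1-e(X)}{1-e^*(X)}\mu_0(X)\right]-(\mu_1-\mu_0).$$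
   Context: $X$ is a random vector of covariates, $T\in\{0,1\}$ a binary treatment, and $Y(1),Y(0)$ are integrable real-valued potential outcomes. Notation: $\mu_t=E[Y(t)]$, $\mu_t(X)=E(Y(t)\mid X)$, $t=0,1$, and $\Delta=\mu_1-\mu_0$ (the average causal effect). $e^{\mathrm{mis}}(x,\beta)$ is a parametric working model (with values in $(0,1)$) for the propensity score $e(X)$, which need not be correctly specified, i.e. $e^*(X)=e^{\mathrm{mis}}(X,\beta^* )$ need not equal $e(X)$. $\hat\beta^*=\hat\beta^*_n$ is an estimator computed from $(T_i,X_i,Y_i)_{i\le n}$, and $\beta^*$ is a fixed parameter value. Regularity assumption (v) (weak law of large numbers with estimated parameter): for each of the functions $g(T,X,Y,\beta)=\frac{TY}{e^{\mathrm{mis}}(X,\beta)}$ and $g(T,X,Y,\beta)=\frac{(1-T)Y}{1-e^{\mathrm{mis}}(X,\beta)}$ one has $\frac1n\sum_{i=1}^n g(T_i,X_i,Y_i,\hat\beta^* )\stackrel{p}{\longrightarrow}E[g(T,X,Y,\beta^* )]$. *)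

theory Defs
  imports "HOL-Probability.Probability"
begin

(* Measurability is part of the notion: for a non-measurable set, measure would return the
   junk value 0 and the limit below would say nothing. *)
definition conv_in_prob ::
  "'a measure \<Rightarrow> (nat \<Rightarrow> 'a \<Rightarrow> 'b::{metric_space, second_countable_topology}) \<Rightarrow> ('a \<Rightarrow> 'b) \<Rightarrow> bool"
where
  "conv_in_prob M Z W \<longleftrightarrow>
     (\<forall>n. Z n \<in> borel_measurable M) \<and> W \<in> borel_measurable M \<and>
     (\<forall>\<epsilon>>0. (\<lambda>n. measure M {\<omega> \<in> space M. dist (Z n \<omega>) (W \<omega>) > \<epsilon>}) \<longlonglongrightarrow> 0)"

(* E(Z | X): a version of the conditional expectation given the sigma-algebra generated by X,
   as a random variable on M. *)
definition cond_exp_given ::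
  "'a measure \<Rightarrow> ('a \<Rightarrow> 'x::topological_space) \<Rightarrow> ('a \<Rightarrow> real) \<Rightarrow> 'a \<Rightarrow> real"
where
  "cond_exp_given M X Z = real_cond_exp M (vimage_algebra (space M) X borel) Z"

definition cond_prob_given ::
  "'a measure \<Rightarrow> ('a \<Rightarrow> 'x::topological_space) \<Rightarrow> 'a set \<Rightarrow> 'a \<Rightarrow> real"
where
  "cond_prob_given M X A = cond_exp_given M X (indicat_real A)"

definition cond_indep_given ::
  "'a measure \<Rightarrow> ('a \<Rightarrow> 'x::topological_space) \<Rightarrow>
   ('a \<Rightarrow> 'c::topological_space) \<Rightarrow> ('a \<Rightarrow> 'd::topological_space) \<Rightarrow> bool"
where
  "cond_indep_given M X U V \<longleftrightarrow>
     U \<in> borel_measurable M \<and> V \<in> borel_measurable M \<and>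
     (\<forall>A \<in> sets borel. \<forall>B \<in> sets borel. AE \<omega> in M.
        cond_prob_given M X {\<omega> \<in> space M. U \<omega> \<in> A \<and> V \<omega> \<in> B} \<omega> =
        cond_prob_given M X {\<omega> \<in> space M. U \<omega> \<in> A} \<omega> *
        cond_prob_given M X {\<omega> \<in> space M. V \<omega> \<in> B} \<omega>)"

definition propensity ::
  "'a measure \<Rightarrow> ('a \<Rightarrow> real) \<Rightarrow> ('a \<Rightarrow> 'x::topological_space) \<Rightarrow> 'a \<Rightarrow> real"
where
  "propensity M T X = cond_prob_given M X {\<omega> \<in> space M. T \<omega> = 1}"

(* Observations are numbered from 1; t, x, y are the realised data and b the estimated parameter. *)
definition ipw1 ::
  "('x \<Rightarrow> 'b \<Rightarrow> real) \<Rightarrow> nat \<Rightarrow> (nat \<Rightarrow> real) \<Rightarrow> (nat \<Rightarrow> 'x) \<Rightarrow> (nat \<Rightarrow> real) \<Rightarrow> 'b \<Rightarrow> real"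
where
  "ipw1 e n t x y b =
     (1 / real n) * (\<Sum>i=1..n. t i * y i / e (x i) b) -
     (1 / real n) * (\<Sum>i=1..n. (1 - t i) * y i / (1 - e (x i) b))"

end

theory Submission
  imports Defs
begin

text \<open>\<open>C * g\<close> dominates the product almost everywhere. An almost sure bound is
  the form in which the overlap condition controls the inverse-probability weights.\<close>

lemma integrable_mult_AE_bounded:
  fixes f g :: "'a \<Rightarrow> real"
  assumes g: "integrable M g" and f: "f \<in> borel_measurable M"
    and bd: "AE x in M. \<bar>f x\<bar> \<le> C"
  shows "integrable M (\<lambda>x. f x * g x)"
proof (rule Bochner_Integration.integrable_bound)
  show "integrable M (\<lambda>x. C * g x)" using g by simp
  show "(\<lambda>x. f x * g x) \<in> borel_measurable M" using f g by measurable
  show "AE x in M. norm (f x * g x) \<le> norm (C * g x)"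
    using bd
  proof eventually_elim
    case (elim x)
    \<comment> \<open>No sign of \<open>C\<close> is assumed, and the norm of \<open>C * g x\<close>
      produces the factor \<open>\<bar>C\<bar>\<close>.\<close>
    then have "\<bar>f x\<bar> \<le> \<bar>C\<bar>" by linarith
    then show ?case by (simp add: abs_mult mult_right_mono)
  qed
qed

text \<open>Gives access to the rules for \<open>real_cond_exp\<close>; it serves below both for the
  sigma-algebra of the covariates and for that of an outcome.\<close>

lemma (in prob_space) finite_measure_subalgebra_vimage:
  assumes "X \<in> M \<rightarrow>\<^sub>M N"
  shows "finite_measure_subalgebra M (vimage_algebra (space M) X N)"
proof unfold_locales
  show "subalgebra M (vimage_algebra (space M) X N)"
    unfolding subalgebra_def using assms
    by (auto simp: sets_vimage_algebra2 measurable_def)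
qed

text \<open>Conditional expectation preserves constant bounds, and an indicator lies between 0 and
  1. This keeps weights bounded after multiplication by a conditional probability.\<close>

lemma (in prob_space) cond_prob_given_bounds:
  assumes X: "X \<in> borel_measurable M" and A: "A \<in> sets M"
  shows "AE \<omega> in M. 0 \<le> cond_prob_given M X A \<omega> \<and> cond_prob_given M X A \<omega> \<le> 1"
proof -
  interpret F: finite_measure_subalgebra M "vimage_algebra (space M) X borel"
    by (rule finite_measure_subalgebra_vimage[OF X])
  have i: "integrable M (indicat_real A)" using A by (simp add: integrable_indicator_iff less_top[symmetric])
  show ?thesis
    using F.real_cond_exp_ge_c[OF i, of 0] F.real_cond_exp_le_c[OF i, of 1]
    by (auto simp: cond_prob_given_def cond_exp_given_def indicator_def)
qed

text \<open>Linearity of conditional expectation. It is needed for the control arm, because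
  \<open>propensity\<close> speaks of the event T = 1 only.\<close>

lemma (in prob_space) cond_prob_given_compl:
  assumes X: "X \<in> borel_measurable M" and A: "A \<in> sets M"
  shows "AE \<omega> in M. cond_prob_given M X (space M - A) \<omega> = 1 - cond_prob_given M X A \<omega>"
proof -
  define G where "G = vimage_algebra (space M) X borel"
  interpret F: finite_measure_subalgebra M G
    unfolding G_def by (rule finite_measure_subalgebra_vimage[OF X])
  have [measurable]: "A \<in> sets M" by (fact A)
  \<comment> \<open>The two integrands agree on \<open>space M\<close> but differ outside it, so the
    passage goes through almost everywhere equality.\<close>
  have "AE \<omega> in M. real_cond_exp M G (indicator (space M - A)) \<omega>
      = real_cond_exp M G (\<lambda>\<omega>. 1 - indicator A \<omega>) \<omega>"
    by (rule F.real_cond_exp_cong) (auto simp: indicator_def)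
  moreover have "AE \<omega> in M. real_cond_exp M G (\<lambda>\<omega>. 1 - indicator A \<omega>) \<omega>
      = real_cond_exp M G (\<lambda>_. 1) \<omega> - real_cond_exp M G (indicator A) \<omega>"
    by (rule F.real_cond_exp_diff) (auto simp: integrable_indicator_iff less_top[symmetric])
  moreover have "AE \<omega> in M. real_cond_exp M G (\<lambda>_. 1) \<omega> = 1"
    by (rule F.real_cond_exp_F_meas) auto
  ultimately show ?thesis
    by (auto simp: cond_prob_given_def cond_exp_given_def G_def)
qed

text \<open>Under conditional independence the residual \<open>D = w(X) (1{V \<in> B} - P(V \<in> B | X))\<close> integrates
  to zero over every event \<open>{U \<in> A}\<close>, so \<open>E(D | U) = 0\<close> and hence \<open>E(U D) = 0\<close>; this avoids
  approximating \<open>U\<close> by simple functions.\<close>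

lemma (in prob_space) cond_indep_given_integral:
  fixes U :: "'a \<Rightarrow> real" and X :: "'a \<Rightarrow> 'x::topological_space" and w :: "'x \<Rightarrow> real"
  assumes X[measurable]: "X \<in> borel_measurable M"
    and U: "integrable M U"
    and ci: "cond_indep_given M X U V"
    and B[measurable]: "B \<in> sets borel"
    and w[measurable]: "w \<in> borel_measurable borel"
    and wb: "AE \<omega> in M. \<bar>w (X \<omega>)\<bar> \<le> C"
  shows "(\<integral>\<omega>. w (X \<omega>) * indicator B (V \<omega>) * U \<omega> \<partial>M) =
    (\<integral>\<omega>. w (X \<omega>) * cond_prob_given M X {\<omega> \<in> space M. V \<omega> \<in> B} \<omega> * cond_exp_given M X U \<omega> \<partial>M)"
proof -
  \<comment> \<open>\<open>G\<close> is sigma(X), where the weight and \<open>p\<close> are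
    measurable; \<open>H\<close> is sigma(U), with respect to which the residual \<open>D\<close>
    has conditional mean zero.\<close>
  define G where "G = vimage_algebra (space M) X borel"
  define H where "H = vimage_algebra (space M) U borel"
  define S where "S = {\<omega> \<in> space M. V \<omega> \<in> B}"
  define p where "p = cond_prob_given M X S"
  define D where "D \<omega> = w (X \<omega>) * indicator S \<omega> - w (X \<omega>) * p \<omega>" for \<omega>
  have [measurable]: "U \<in> borel_measurable M" "V \<in> borel_measurable M"
    and ci': "\<And>A. A \<in> sets borel \<Longrightarrow> AE \<omega> in M.
        cond_prob_given M X {\<omega> \<in> space M. U \<omega> \<in> A \<and> V \<omega> \<in> B} \<omega> =
        cond_prob_given M X {\<omega> \<in> space M. U \<omega> \<in> A} \<omega> * p \<omega>"
    using ci B by (auto simp: cond_indep_given_def p_def S_def)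
  interpret G: finite_measure_subalgebra M G
    unfolding G_def by (rule finite_measure_subalgebra_vimage[OF X])
  interpret H: finite_measure_subalgebra M H
    unfolding H_def by (rule finite_measure_subalgebra_vimage) measurable
  have XG[measurable]: "X \<in> borel_measurable G"
    unfolding G_def by (rule measurable_vimage_algebra1) simp
  have UH[measurable]: "U \<in> borel_measurable H"
    unfolding H_def by (rule measurable_vimage_algebra1) simp
  have S[measurable]: "S \<in> sets M" unfolding S_def by measurable
  have pG[measurable]: "p \<in> borel_measurable G"
    unfolding p_def cond_prob_given_def cond_exp_given_def G_def[symmetric] by simp
  have p_meas[measurable]: "p \<in> borel_measurable M"
    by (rule measurable_from_subalg[OF G.subalg pG])
  have wX: "(\<lambda>\<omega>. w (X \<omega>)) \<in> borel_measurable M" by measurable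
  \<comment> \<open>Since \<open>p\<close> lies in [0,1] almost surely, the bound \<open>C\<close>
    for the weight also bounds weight times \<open>p\<close>.\<close>
  have wpb: "AE \<omega> in M. \<bar>w (X \<omega>) * p \<omega>\<bar> \<le> C"
    using wb cond_prob_given_bounds[OF X S, folded p_def]
  proof eventually_elim
    case (elim \<omega>)
    then have "\<bar>w (X \<omega>)\<bar> * \<bar>p \<omega>\<bar> \<le> \<bar>w (X \<omega>)\<bar> * 1" by (intro mult_left_mono) auto
    then show ?case using elim by (simp add: abs_mult)
  qed
  have iw: "integrable M (\<lambda>\<omega>. w (X \<omega>) * g \<omega>)" if "integrable M g" for g
    by (rule integrable_mult_AE_bounded[OF that wX wb])
  have iwp: "integrable M (\<lambda>\<omega>. w (X \<omega>) * p \<omega> * g \<omega>)" if "integrable M g" for g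
    by (rule integrable_mult_AE_bounded[OF that _ wpb]) measurable
  have ind: "integrable M (indicat_real A)" if "A \<in> sets M" for A
    using that by (simp add: integrable_indicator_iff less_top[symmetric])
  have D_int: "integrable M D"
    unfolding D_def using iw[OF ind[OF S]] iwp[of "\<lambda>_. 1"] by simp
  \<comment> \<open>The zero on the right is the candidate for E(D | U): equal integrals over all
    events of \<open>H\<close> characterise the conditional expectation.\<close>
  have D_zero: "(\<integral>\<omega>\<in>A. D \<omega> \<partial>M) = (\<integral>\<omega>\<in>A. 0 \<partial>M)" if "A \<in> sets H" for A
  proof -
    \<comment> \<open>Every event of sigma(U) is a preimage under \<open>U\<close> of a Borel set,
      the kind of event that conditional independence speaks of.\<close>
    have "A \<in> {U -` A' \<inter> space M | A'. A' \<in> sets borel}"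
      using that unfolding H_def by (subst (asm) sets_vimage_algebra2) auto
    then obtain A' where A'[measurable]: "A' \<in> sets borel" and A: "A = {\<omega> \<in> space M. U \<omega> \<in> A'}"
      by (auto simp: vimage_def Int_def conj_commute)
    have Am[measurable]: "A \<in> sets M" unfolding A by measurable
    have AS: "{\<omega> \<in> space M. U \<omega> \<in> A' \<and> V \<omega> \<in> B} = A \<inter> S" unfolding A S_def by auto
    \<comment> \<open>Condition on X, factor P(A and S | X) into P(A | X) times \<open>p\<close>,
      then undo the conditioning on the factor for \<open>A\<close> alone; this works because both
      the weight and weight times \<open>p\<close> are measurable with respect to
      \<open>G\<close>.\<close>
    have "(\<integral>\<omega>. w (X \<omega>) * indicat_real (A \<inter> S) \<omega> \<partial>M)
        = (\<integral>\<omega>. w (X \<omega>) * real_cond_exp M G (indicat_real (A \<inter> S)) \<omega> \<partial>M)"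
      by (rule G.real_cond_exp_intg(2)[symmetric]) (auto intro!: iw ind)
    also have "\<dots> = (\<integral>\<omega>. w (X \<omega>) * p \<omega> * real_cond_exp M G (indicat_real A) \<omega> \<partial>M)"
      using ci'[OF A', unfolded AS, folded A]
      by (intro integral_cong_AE)
         (auto simp: cond_prob_given_def cond_exp_given_def G_def[symmetric] elim: eventually_mono)
    also have "\<dots> = (\<integral>\<omega>. w (X \<omega>) * p \<omega> * indicat_real A \<omega> \<partial>M)"
      by (rule G.real_cond_exp_intg(2)) (auto intro!: iwp ind)
    finally have eq: "(\<integral>\<omega>. w (X \<omega>) * indicat_real (A \<inter> S) \<omega> \<partial>M)
      = (\<integral>\<omega>. w (X \<omega>) * p \<omega> * indicat_real A \<omega> \<partial>M)" .
    have "(\<integral>\<omega>\<in>A. D \<omega> \<partial>M) = (\<integral>\<omega>. w (X \<omega>) * indicat_real (A \<inter> S) \<omega> - w (X \<omega>) * p \<omega> * indicat_real A \<omega> \<partial>M)"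
      unfolding set_lebesgue_integral_def D_def
      by (intro Bochner_Integration.integral_cong) (auto simp: indicator_def)
    also have "\<dots> = 0"
      using eq by (subst Bochner_Integration.integral_diff) (auto intro!: iw iwp ind)
    finally show ?thesis by simp
  qed
  \<comment> \<open>Pulling \<open>U\<close> out of E(. | U) requires the product to be integrable.
    Each of its two terms is \<open>U\<close>, possibly cut off to \<open>S\<close>, times an almost
    surely bounded factor.\<close>
  have UD: "integrable M (\<lambda>\<omega>. U \<omega> * D \<omega>)"
  proof -
    have "integrable M (\<lambda>\<omega>. w (X \<omega>) * (U \<omega> * indicator S \<omega>) - w (X \<omega>) * p \<omega> * U \<omega>)"
      using U by (intro Bochner_Integration.integrable_diff iw iwp integrable_real_mult_indicator) auto
    then show ?thesis by (simp add: D_def algebra_simps)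
  qed
  have "AE \<omega> in M. real_cond_exp M H D \<omega> = 0"
    by (rule H.real_cond_exp_charact[OF D_zero D_int]) auto
  then have "(\<integral>\<omega>. U \<omega> * real_cond_exp M H D \<omega> \<partial>M) = (\<integral>\<omega>. 0 \<partial>M)"
    by (intro integral_cong_AE) auto
  \<comment> \<open>\<open>U\<close> is measurable with respect to \<open>H\<close>, so E(U E(D |
    U)) = E(U D).\<close>
  moreover have "(\<integral>\<omega>. U \<omega> * real_cond_exp M H D \<omega> \<partial>M) = (\<integral>\<omega>. U \<omega> * D \<omega> \<partial>M)"
    using D_int by (intro H.real_cond_exp_intg(2)[OF UD]) auto
  ultimately have "(\<integral>\<omega>. U \<omega> * D \<omega> \<partial>M) = 0" by simp
  also have "(\<integral>\<omega>. U \<omega> * D \<omega> \<partial>M)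
      = (\<integral>\<omega>. w (X \<omega>) * (U \<omega> * indicator S \<omega>) - w (X \<omega>) * p \<omega> * U \<omega> \<partial>M)"
    by (simp add: D_def algebra_simps)
  also have "\<dots> = (\<integral>\<omega>. w (X \<omega>) * (U \<omega> * indicator S \<omega>) \<partial>M) - (\<integral>\<omega>. w (X \<omega>) * p \<omega> * U \<omega> \<partial>M)"
    using U by (intro Bochner_Integration.integral_diff iw iwp integrable_real_mult_indicator) auto
  finally have "(\<integral>\<omega>. w (X \<omega>) * (U \<omega> * indicator S \<omega>) \<partial>M) = (\<integral>\<omega>. w (X \<omega>) * p \<omega> * U \<omega> \<partial>M)"
    by simp
  \<comment> \<open>Back to sigma(X): weight times \<open>p\<close> is measurable there, so
    \<open>U\<close> may be replaced by E(U | X).\<close>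
  moreover have "(\<integral>\<omega>. w (X \<omega>) * p \<omega> * real_cond_exp M G U \<omega> \<partial>M) = (\<integral>\<omega>. w (X \<omega>) * p \<omega> * U \<omega> \<partial>M)"
    using iwp[OF U] by (intro G.real_cond_exp_intg(2)) auto
  moreover have "(\<integral>\<omega>. w (X \<omega>) * indicator B (V \<omega>) * U \<omega> \<partial>M) = (\<integral>\<omega>. w (X \<omega>) * (U \<omega> * indicator S \<omega>) \<partial>M)"
    by (intro Bochner_Integration.integral_cong) (auto simp: S_def indicator_def)
  ultimately show ?thesis
    by (simp add: p_def S_def cond_exp_given_def G_def)
qed

text \<open>If the error of the difference exceeds \<epsilon>, one of the two errors exceeds
  \<epsilon> / 2; the union bound then squeezes the probability to 0.\<close>

lemma (in prob_space) conv_in_prob_diff: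
  fixes Z Z' :: "nat \<Rightarrow> 'a \<Rightarrow> real"
  assumes "conv_in_prob M Z W" and "conv_in_prob M Z' W'"
  shows "conv_in_prob M (\<lambda>n \<omega>. Z n \<omega> - Z' n \<omega>) (\<lambda>\<omega>. W \<omega> - W' \<omega>)"
proof -
  have [measurable]: "\<And>n. Z n \<in> borel_measurable M" "\<And>n. Z' n \<in> borel_measurable M"
      "W \<in> borel_measurable M" "W' \<in> borel_measurable M"
    using assms by (auto simp: conv_in_prob_def)
  have "(\<lambda>n. prob {\<omega> \<in> space M. dist (Z n \<omega> - Z' n \<omega>) (W \<omega> - W' \<omega>) > \<epsilon>}) \<longlonglongrightarrow> 0" if "\<epsilon> > 0" for \<epsilon>
  proof (rule tendsto_sandwich[OF _ _ tendsto_const])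
    let ?P = "\<lambda>n. prob {\<omega> \<in> space M. dist (Z n \<omega>) (W \<omega>) > \<epsilon> / 2}"
    let ?Q = "\<lambda>n. prob {\<omega> \<in> space M. dist (Z' n \<omega>) (W' \<omega>) > \<epsilon> / 2}"
    show "(\<lambda>n. ?P n + ?Q n) \<longlonglongrightarrow> 0"
      using assms half_gt_zero[OF that] unfolding conv_in_prob_def by (intro tendsto_add_zero) blast+
    show "\<forall>\<^sub>F n in sequentially. prob {\<omega> \<in> space M. dist (Z n \<omega> - Z' n \<omega>) (W \<omega> - W' \<omega>) > \<epsilon>} \<le> ?P n + ?Q n"
    proof (intro always_eventually allI)
      fix n
      have "prob {\<omega> \<in> space M. dist (Z n \<omega> - Z' n \<omega>) (W \<omega> - W' \<omega>) > \<epsilon>}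
          \<le> prob ({\<omega> \<in> space M. dist (Z n \<omega>) (W \<omega>) > \<epsilon> / 2} \<union> {\<omega> \<in> space M. dist (Z' n \<omega>) (W' \<omega>) > \<epsilon> / 2})"
        by (intro finite_measure_mono) (auto simp: dist_real_def abs_if split: if_splits)
      also have "\<dots> \<le> ?P n + ?Q n"
        by (intro measure_Un_le) measurable
      finally show "prob {\<omega> \<in> space M. dist (Z n \<omega> - Z' n \<omega>) (W \<omega> - W' \<omega>) > \<epsilon>} \<le> ?P n + ?Q n" .
    qed
  qed auto
  then show ?thesis by (simp add: conv_in_prob_def)
qed

lemma conv_in_prob_const: "conv_in_prob M (\<lambda>_ _. c) (\<lambda>_. c)"
  by (simp add: conv_in_prob_def)

theorem theorem8:
  fixes M :: "'a measure"
    and X :: "'a \<Rightarrow> 'x::euclidean_space"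
    and T Y1 Y0 Y :: "'a \<Rightarrow> real"
    and Ts :: "nat \<Rightarrow> 'a \<Rightarrow> real"
    and Xs :: "nat \<Rightarrow> 'a \<Rightarrow> 'x"
    and Ys :: "nat \<Rightarrow> 'a \<Rightarrow> real"
    and \<Theta> :: "'b::euclidean_space set"
    and emis :: "'x \<Rightarrow> 'b \<Rightarrow> real"
    and \<beta>star :: 'b
    and est :: "nat \<Rightarrow> (nat \<Rightarrow> real \<times> 'x \<times> real) \<Rightarrow> 'b"
    and \<beta>hat :: "nat \<Rightarrow> 'a \<Rightarrow> 'b"
  assumes "prob_space M"
    and X_rv: "X \<in> borel_measurable M"
    and T_rv: "T \<in> borel_measurable M"
    and T_binary: "\<And>\<omega>. \<omega> \<in> space M \<Longrightarrow> T \<omega> \<in> {0, 1}"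
    and Y1_int: "integrable M Y1"
    and Y0_int: "integrable M Y0"
    and consistency: "\<And>\<omega>. \<omega> \<in> space M \<Longrightarrow> Y \<omega> = T \<omega> * Y1 \<omega> + (1 - T \<omega>) * Y0 \<omega>"
    and sample_indep:
      "prob_space.indep_vars M (\<lambda>_. borel) (\<lambda>i \<omega>. (Ts i \<omega>, Xs i \<omega>, Ys i \<omega>)) {1..}"
    and sample_distr:
      "\<And>i. i \<ge> 1 \<Longrightarrow>
         distr M borel (\<lambda>\<omega>. (Ts i \<omega>, Xs i \<omega>, Ys i \<omega>)) = distr M borel (\<lambda>\<omega>. (T \<omega>, X \<omega>, Y \<omega>))"
    and model_meas: "\<And>\<beta>. \<beta> \<in> \<Theta> \<Longrightarrow> (\<lambda>x. emis x \<beta>) \<in> borel_measurable borel"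
    and model_range: "\<And>x \<beta>. \<beta> \<in> \<Theta> \<Longrightarrow> 0 < emis x \<beta> \<and> emis x \<beta> < 1"
    and \<beta>star: "\<beta>star \<in> \<Theta>"
    and est_meas: "\<And>n. est n \<in> (\<Pi>\<^sub>M i\<in>{1..n}. borel) \<rightarrow>\<^sub>M restrict_space borel \<Theta>"
    and \<beta>hat: "\<And>n \<omega>. \<omega> \<in> space M \<Longrightarrow> \<beta>hat n \<omega> = est n (\<lambda>i\<in>{1..n}. (Ts i \<omega>, Xs i \<omega>, Ys i \<omega>))"
    and unconfounded1: "cond_indep_given M X Y1 T"
    and unconfounded0: "cond_indep_given M X Y0 T"
    and overlap: "\<exists>\<eta>>0. AE \<omega> in M. \<eta> < propensity M T X \<omega> \<and> propensity M T X \<omega> < 1 - \<eta>"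
    and \<beta>hat_conv: "conv_in_prob M \<beta>hat (\<lambda>_. \<beta>star)"
    and overlap_mis: "\<exists>\<nu>>0. AE \<omega> in M. \<nu> < emis (X \<omega>) \<beta>star \<and> emis (X \<omega>) \<beta>star < 1 - \<nu>"
    and wlln1:
      "conv_in_prob M
         (\<lambda>n \<omega>. (1 / real n) * (\<Sum>i=1..n. Ts i \<omega> * Ys i \<omega> / emis (Xs i \<omega>) (\<beta>hat n \<omega>)))
         (\<lambda>_. \<integral>\<omega>. T \<omega> * Y \<omega> / emis (X \<omega>) \<beta>star \<partial>M)"
    and wlln0:
      "conv_in_prob M
         (\<lambda>n \<omega>. (1 / real n) * (\<Sum>i=1..n. (1 - Ts i \<omega>) * Ys i \<omega> / (1 - emis (Xs i \<omega>) (\<beta>hat n \<omega>))))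
         (\<lambda>_. \<integral>\<omega>. (1 - T \<omega>) * Y \<omega> / (1 - emis (X \<omega>) \<beta>star) \<partial>M)"
  shows
    "conv_in_prob M
       (\<lambda>n \<omega>. ipw1 emis n (\<lambda>i. Ts i \<omega>) (\<lambda>i. Xs i \<omega>) (\<lambda>i. Ys i \<omega>) (\<beta>hat n \<omega>)
          - ((\<integral>\<omega>. Y1 \<omega> \<partial>M) - (\<integral>\<omega>. Y0 \<omega> \<partial>M)))
       (\<lambda>_. (\<integral>\<omega>. propensity M T X \<omega> / emis (X \<omega>) \<beta>star * cond_exp_given M X Y1 \<omega> \<partial>M)
          - (\<integral>\<omega>. (1 - propensity M T X \<omega>) / (1 - emis (X \<omega>) \<beta>star) * cond_exp_given M X Y0 \<omega> \<partial>M)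
          - ((\<integral>\<omega>. Y1 \<omega> \<partial>M) - (\<integral>\<omega>. Y0 \<omega> \<partial>M)))"
proof -
  interpret prob_space M by (rule assms(1))
  note [measurable] = X_rv T_rv model_meas[OF \<beta>star]
  obtain \<nu> where \<nu>: "\<nu> > 0" and ae: "AE \<omega> in M. \<nu> < emis (X \<omega>) \<beta>star \<and> emis (X \<omega>) \<beta>star < 1 - \<nu>"
    using overlap_mis by blast
  \<comment> \<open>The bound \<nu> on \<open>emis\<close> from below controls the treated weight,
    and the bound 1 - \<nu> from above controls the control weight.\<close>
  have w1: "AE \<omega> in M. \<bar>1 / emis (X \<omega>) \<beta>star\<bar> \<le> 1 / \<nu>"
    and w0: "AE \<omega> in M. \<bar>1 / (1 - emis (X \<omega>) \<beta>star)\<bar> \<le> 1 / \<nu>"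
    using ae by (eventually_elim, use \<nu> in \<open>simp add: frac_le\<close>)+
  define S where "S = {\<omega> \<in> space M. T \<omega> = 1}"
  have S[measurable]: "S \<in> sets M" unfolding S_def by measurable
  \<comment> \<open>Binary treatment makes T = 0 the complement of T = 1.\<close>
  have S0: "{\<omega> \<in> space M. T \<omega> = 0} = space M - S"
    using T_binary by (auto simp: S_def)
  have [measurable]: "cond_exp_given M X Z \<in> borel_measurable M" for Z
    unfolding cond_exp_given_def by simp
  have [measurable]: "cond_prob_given M X A \<in> borel_measurable M" for A
    unfolding cond_prob_given_def by simp
  \<comment> \<open>\<open>wlln1\<close> and \<open>wlln0\<close> supply the limits of the two
    averages; what remains is to identify these limits. By consistency T Y is Y1 on T = 1 and 0
    elsewhere, which gives the integrand of \<open>cond_indep_given_integral\<close> with weight 1 /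
    \<open>emis\<close> and event {1}.\<close>
  have "(\<integral>\<omega>. T \<omega> * Y \<omega> / emis (X \<omega>) \<beta>star \<partial>M)
      = (\<integral>\<omega>. 1 / emis (X \<omega>) \<beta>star * indicator {1} (T \<omega>) * Y1 \<omega> \<partial>M)"
    using T_binary consistency by (intro Bochner_Integration.integral_cong) fastforce+
  also have "\<dots> = (\<integral>\<omega>. 1 / emis (X \<omega>) \<beta>star * cond_prob_given M X {\<omega> \<in> space M. T \<omega> \<in> {1}} \<omega>
      * cond_exp_given M X Y1 \<omega> \<partial>M)"
    by (intro cond_indep_given_integral[OF X_rv Y1_int unconfounded1 _ _ w1]) measurable
  finally have 1: "(\<integral>\<omega>. T \<omega> * Y \<omega> / emis (X \<omega>) \<beta>star \<partial>M)
      = (\<integral>\<omega>. propensity M T X \<omega> / emis (X \<omega>) \<beta>star * cond_exp_given M X Y1 \<omega> \<partial>M)"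
    by (simp add: propensity_def)
  \<comment> \<open>The control arm is treated in the same way, with event {0} and weight 1 / (1 -
    \<open>emis\<close>).\<close>
  have "(\<integral>\<omega>. (1 - T \<omega>) * Y \<omega> / (1 - emis (X \<omega>) \<beta>star) \<partial>M)
      = (\<integral>\<omega>. 1 / (1 - emis (X \<omega>) \<beta>star) * indicator {0} (T \<omega>) * Y0 \<omega> \<partial>M)"
    using T_binary consistency by (intro Bochner_Integration.integral_cong) fastforce+
  also have "\<dots> = (\<integral>\<omega>. 1 / (1 - emis (X \<omega>) \<beta>star) * cond_prob_given M X {\<omega> \<in> space M. T \<omega> \<in> {0}} \<omega>
      * cond_exp_given M X Y0 \<omega> \<partial>M)"
    by (intro cond_indep_given_integral[OF X_rv Y0_int unconfounded0 _ _ w0]) measurable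
  also have "\<dots> = (\<integral>\<omega>. 1 / (1 - emis (X \<omega>) \<beta>star) * cond_prob_given M X (space M - S) \<omega>
      * cond_exp_given M X Y0 \<omega> \<partial>M)"
    by (simp add: S0)
  \<comment> \<open>P(T = 0 | X) equals one minus the propensity only almost surely, which suffices
    under the integral.\<close>
  also have "\<dots> = (\<integral>\<omega>. (1 - propensity M T X \<omega>) / (1 - emis (X \<omega>) \<beta>star) * cond_exp_given M X Y0 \<omega> \<partial>M)"
    unfolding propensity_def S_def[symmetric]
    using cond_prob_given_compl[OF X_rv S]
    by (intro integral_cong_AE) (measurable, auto elim!: eventually_mono)
  finally have 0: "(\<integral>\<omega>. (1 - T \<omega>) * Y \<omega> / (1 - emis (X \<omega>) \<beta>star) \<partial>M)
      = (\<integral>\<omega>. (1 - propensity M T X \<omega>) / (1 - emis (X \<omega>) \<beta>star) * cond_exp_given M X Y0 \<omega> \<partial>M)" .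
  show ?thesis
    unfolding ipw1_def
    \<comment> \<open>The estimator is a difference of the two averages, and centring by the average
      causal effect subtracts a constant sequence.\<close>
    by (intro conv_in_prob_diff conv_in_prob_const wlln1[unfolded 1] wlln0[unfolded 0])
qed

end
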